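(* Let $A\in\mathbb{R}^{n\times n}$, $B\in\mathbb{R}^{n\times p}$, $C\in\mathbb{R}^{m\times n}$, let $R\in\mathbb{R}^{p\times p}$ be symmetric positive definite, and let $\alpha>0$. Define $F:\mathbb{S}_+^n\to\mathbb{S}_+^n$ by $$F(X)=A^\top S(X)A+\alpha\,\mathrm{tr}(X)\,C^\top C,\qquad S(X)=X-XB\big(\alpha\,\mathrm{tr}(X)R+B^\top XB\big)^{-1}B^\top X$$ for $X\neq0$, and $F(0)=0$. Then $F$ is continuous, homogeneous, order-preserving and concave. If moreover $(A,C)$ is observable, then the $n$-fold composition $F^n$ is strongly order-preserving.
   Context: $\mathbb{S}_+^n$ is the cone of real symmetric positive semidefinite $n\times n$ matrices, in the space of real symmetric $n\times n$ matrices; its interior $\mathrm{Int}\,\mathbb{S}_+^n$ is the set of positive definite matrices, and $X\preceq Y$ means $Y-X\in\mathbb{S}_+^n$. The pair $(A,C)$ is observable if the stacked matrix $\mathrm{col}(C,CA,\dots,CA^{n-1})$ has full (column) rank $n$. For a map $T:\mathbb{S}_+^n\to\mathbb{S}_+^n$: $T$ is homogeneous if $T(cX)=cT(X)$ for all $X\in\mathbb{S}_+^n$ and $c\ge0$; $T$ is order-preserving if $0\preceq X\preceq Y$ implies $0\preceq T(X)\preceq T(Y)$; $T$ is strongly (equivalently, strictly) order-preserving if $0\preceq X\preceq Y$ and $X\ne Y$ imply $T(Y)-T(X)\in\mathrm{Int}\,\mathbb{S}_+^n$; $T$ is concave if $T(\theta X+(1-\theta)Y)\succeq\theta T(X)+(1-\theta)T(Y)$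 for all $X,Y\in\mathbb{S}_+^n$ and $\theta\in[0,1]$. *)

theory Defs
  imports "HOL-Analysis.Analysis"
begin

definition sym_mats :: "(real^'n^'n) set" where
  "sym_mats = {X. transpose X = X}"

definition psd_cone :: "(real^'n^'n) set" where
  "psd_cone = {X \<in> sym_mats. \<forall>v. 0 \<le> v \<bullet> (X *v v)}"

definition pos_def :: "real^'n^'n \<Rightarrow> bool" where
  "pos_def X \<longleftrightarrow> X \<in> sym_mats \<and> (\<forall>v. v \<noteq> 0 \<longrightarrow> 0 < v \<bullet> (X *v v))"

text \<open>
  The interior is taken relative to the space of symmetric matrices; in the space of all matrices
  the cone has empty interior as soon as there are at least two dimensions.
\<close>

definition psd_int :: "(real^'n^'n) set" where
  "psd_int = (top_of_set sym_mats) interior_of psd_cone"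

text \<open>
  The order \<open>\<le>\<close> that the library provides on matrices is the entrywise one, hence a separate symbol
  for the Loewner order.
\<close>

definition loewner_le :: "real^'n^'n \<Rightarrow> real^'n^'n \<Rightarrow> bool"  (infix \<open>\<preceq>\<close> 50) where
  "X \<preceq> Y \<longleftrightarrow> Y - X \<in> psd_cone"

lemma psd_int_eq_pos_def: "psd_int = {X :: real^'n^'n. pos_def X}"
proof (intro set_eqI iffI)
  fix X :: "real^'n^'n"
  assume "X \<in> psd_int"
  then obtain T where T: "open T" "X \<in> T" "X \<in> sym_mats" "T \<inter> sym_mats \<subseteq> psd_cone"
    unfolding psd_int_def interior_of_def openin_open by blast
  obtain e where e: "e > 0" "ball X e \<subseteq> T"
    using T openE by metis
  define d where "d = e / (2 * (norm (mat 1 :: real^'n^'n) + 1))"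
  have d: "d > 0" 
    using e(1) unfolding d_def by (simp add: add_nonneg_pos)
  have "d * norm (mat 1 :: real^'n^'n) \<le> d * (norm (mat 1 :: real^'n^'n) + 1)"
    using d by simp
  also have "\<dots> = e / 2"
    using norm_ge_zero[of "mat 1 :: real^'n^'n"] unfolding d_def
    by (simp add: add_nonneg_eq_0_iff divide_simps)
  finally have "d * norm (mat 1 :: real^'n^'n) < e"
    using e(1) by simp
  hence "X - d *\<^sub>R mat 1 \<in> ball X e"
    using d by (simp add: dist_norm)
  moreover have "X - d *\<^sub>R mat 1 \<in> sym_mats"
    using T(3) by (simp add: sym_mats_def transpose_def vec_eq_iff mat_def)
  ultimately have psd: "X - d *\<^sub>R mat 1 \<in> psd_cone"
    using e T by blast
  have "0 < v \<bullet> (X *v v)" if "v \<noteq> 0" for v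
  proof -
    have "0 \<le> v \<bullet> ((X - d *\<^sub>R mat 1) *v v)"
      using psd by (simp add: psd_cone_def)
    also have "\<dots> = v \<bullet> (X *v v) - d * (v \<bullet> v)"
      by (simp add: matrix_vector_mult_diff_rdistrib inner_diff_right
          flip: scaleR_matrix_vector_assoc)
    finally show ?thesis
      using d that by (smt (verit) inner_gt_zero_iff mult_pos_pos)
  qed
  then show "X \<in> {X. pos_def X}"
    using T(3) by (simp add: pos_def_def)
next
  fix X :: "real^'n^'n"
  assume "X \<in> {X. pos_def X}"
  then have X: "X \<in> sym_mats" "\<And>v. v \<noteq> 0 \<Longrightarrow> 0 < v \<bullet> (X *v v)"
    by (auto simp: pos_def_def)
  have "\<exists>u \<in> sphere (0 :: real^'n) 1. \<forall>v \<in> sphere 0 1. u \<bullet> (X *v u) \<le> v \<bullet> (X *v v)"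
    by (intro continuous_attains_inf continuous_intros linear_continuous_on) auto
  then obtain u where u: "norm u = 1" "\<And>v. norm v = 1 \<Longrightarrow> u \<bullet> (X *v u) \<le> v \<bullet> (X *v v)"
    by auto
  define c where "c = u \<bullet> (X *v u)"
  define N where "N = real CARD('n) * real CARD('n)"
  have c: "c > 0"
    using X(2)[of u] u(1) unfolding c_def by force
  have N: "N > 0"
    unfolding N_def by simp
  have lower: "c * (norm v)\<^sup>2 \<le> v \<bullet> (X *v v)" for v
  proof (cases "v = 0")
    case False
    have "c \<le> (v /\<^sub>R norm v) \<bullet> (X *v (v /\<^sub>R norm v))"
      using u(2)[of "v /\<^sub>R norm v"] False unfolding c_def by simp
    also have "\<dots> = (v \<bullet> (X *v v)) / (norm v)\<^sup>2"
      by (simp add: matrix_vector_mult_scaleR power2_eq_square divide_simps)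
    finally show ?thesis
      using False by (simp add: field_simps)
  qed simp
  have "Y \<in> psd_cone" if Y: "Y \<in> sym_mats" "dist X Y < c / N" for Y
  proof -
    have "\<bar>(X - Y) $ i $ j\<bar> \<le> norm (X - Y)" for i j
      by (metis component_le_norm_cart Finite_Cartesian_Product.norm_nth_le order_trans
          real_norm_def)
    then have "onorm ((*v) (X - Y)) \<le> real CARD('n) * real CARD('n) * norm (X - Y)"
      by (rule onorm_le_matrix_component)
    also have "\<dots> \<le> c"
      using Y(2) N unfolding N_def dist_norm by (simp add: field_simps)
    finally have on: "onorm ((*v) (X - Y)) \<le> c" .
    have "0 \<le> v \<bullet> (Y *v v)" for v
    proof -
      have "v \<bullet> ((X - Y) *v v) \<le> norm v * norm ((X - Y) *v v)"
        by (rule norm_cauchy_schwarz)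
      also have "\<dots> \<le> norm v * (c * norm v)"
        using onorm[OF matrix_vector_mul_bounded_linear[of "X - Y"], of v]
          mult_right_mono[OF on norm_ge_zero[of v]]
        by (intro mult_left_mono) auto
      finally have "v \<bullet> ((X - Y) *v v) \<le> c * (norm v)\<^sup>2"
        by (simp add: power2_eq_square algebra_simps)
      then show ?thesis
        using lower[of v] by (simp add: matrix_vector_mult_diff_rdistrib inner_diff_right)
    qed
    then show ?thesis
      using Y(1) by (simp add: psd_cone_def)
  qed
  then have "sym_mats \<inter> ball X (c / N) \<subseteq> psd_cone"
    by auto
  moreover have "X \<in> sym_mats \<inter> ball X (c / N)"
    using X(1) c N by simp
  ultimately show "X \<in> psd_int"
    unfolding psd_int_def interior_of_def openin_open by blast
qed

definition homogeneous :: "(real^'n^'n \<Rightarrow> real^'n^'n) \<Rightarrow> bool" where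
  "homogeneous T \<longleftrightarrow> (\<forall>X \<in> psd_cone. \<forall>c \<ge> 0. T (c *\<^sub>R X) = c *\<^sub>R T X)"

definition order_preserving :: "(real^'n^'n \<Rightarrow> real^'n^'n) \<Rightarrow> bool" where
  "order_preserving T \<longleftrightarrow> (\<forall>X Y. 0 \<preceq> X \<and> X \<preceq> Y \<longrightarrow> 0 \<preceq> T X \<and> T X \<preceq> T Y)"

definition strongly_order_preserving :: "(real^'n^'n \<Rightarrow> real^'n^'n) \<Rightarrow> bool" where
  "strongly_order_preserving T \<longleftrightarrow> (\<forall>X Y. 0 \<preceq> X \<and> X \<preceq> Y \<and> X \<noteq> Y \<longrightarrow> T Y - T X \<in> psd_int)"

definition loewner_concave :: "(real^'n^'n \<Rightarrow> real^'n^'n) \<Rightarrow> bool" where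
  "loewner_concave T \<longleftrightarrow>
     (\<forall>X \<in> psd_cone. \<forall>Y \<in> psd_cone. \<forall>\<theta> \<in> {0..1}.
        \<theta> *\<^sub>R T X + (1 - \<theta>) *\<^sub>R T Y \<preceq> T (\<theta> *\<^sub>R X + (1 - \<theta>) *\<^sub>R Y))"

text \<open>The power \<open>^\<close> on the type of square matrices is entrywise.\<close>

definition mat_pow :: "real^'n^'n \<Rightarrow> nat \<Rightarrow> real^'n^'n" where
  "mat_pow A k = (((**) A) ^^ k) (mat 1)"

text \<open>
  The rows of the stacked matrix \<open>col(C, CA, \<dots>, CA^(n-1))\<close> are indexed by pairs of a block
  index and a row index inside the block. The block index set is \<open>'n\<close> itself, which
  \<open>to_nat_on UNIV\<close> maps bijectively onto \<open>{..<CARD('n)}\<close> (\<open>to_nat_on_finite\<close>); the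
  resulting order of the blocks is arbitrary, which does not affect the rank.
\<close>

definition obs_matrix :: "real^'n^'n \<Rightarrow> real^'n^'m \<Rightarrow> real^'n^('n \<times> 'm)" where
  "obs_matrix A C = (\<chi> r. (C ** mat_pow A (to_nat_on (UNIV :: 'n set) (fst r))) $ snd r)"

definition observable :: "real^'n^'n \<Rightarrow> real^'n^'m \<Rightarrow> bool" where
  "observable A C \<longleftrightarrow> rank (obs_matrix A C) = CARD('n)"

text \<open>
  For \<open>X \<noteq> 0\<close> in the cone, \<open>\<alpha> > 0\<close> and positive definite \<open>R\<close>, the matrix inverted in
  \<open>riccati_S\<close> is positive definite, so \<open>matrix_inv\<close> is the actual inverse.
\<close>

definition riccati_S ::
  "real^'p^'n \<Rightarrow> real^'p^'p \<Rightarrow> real \<Rightarrow> real^'n^'n \<Rightarrow> real^'n^'n" where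
  "riccati_S B R \<alpha> X =
     X - X ** B ** matrix_inv ((\<alpha> * trace X) *\<^sub>R R + transpose B ** X ** B) ** transpose B ** X"

definition riccati_F ::
  "real^'n^'n \<Rightarrow> real^'p^'n \<Rightarrow> real^'n^'m \<Rightarrow> real^'p^'p \<Rightarrow> real \<Rightarrow> real^'n^'n \<Rightarrow> real^'n^'n" where
  "riccati_F A B C R \<alpha> X =
     (if X = 0 then 0
      else transpose A ** riccati_S B R \<alpha> X ** A + (\<alpha> * trace X) *\<^sub>R (transpose C ** C))"

end

theory Submission
  imports Defs
begin

text \<open>
  Completing the square in \<open>u\<close> shows that \<open>v \<bullet> F(X) v\<close> is the minimum over \<open>u\<close> of the cost
  \<open>(A v - B u) \<bullet> X (A v - B u) + \<alpha> tr(X) (u \<bullet> R u) + \<alpha> tr(X) |C v|\<^sup>2\<close>, which is linear in \<open>X\<close> and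
  nonnegative on the cone. Hence \<open>F\<close> is homogeneous and superadditive, which gives concavity,
  monotonicity and \<open>F(Y) - F(X) \<succeq> F(Y - X)\<close> for \<open>X \<preceq> Y\<close>. Iterating the last inequality reduces the
  strong order preservation of \<open>F\<^sup>n\<close> to the definiteness of \<open>F\<^sup>n(D)\<close> for nonzero \<open>D\<close> in the cone.
  If \<open>E \<noteq> 0\<close> and \<open>v \<bullet> F(E) v = 0\<close>, all three terms of the minimal cost vanish, so \<open>u = 0\<close>, \<open>C v = 0\<close>
  and \<open>A v\<close> is isotropic for \<open>E\<close>; descending from \<open>F\<^sup>n(D)\<close> to \<open>D\<close> yields \<open>C A\<^sup>j v = 0\<close> for all \<open>j < n\<close>.
  Continuity holds away from \<open>0\<close> by Cramer's rule, and at \<open>0\<close> because the entries of \<open>F(X)\<close> are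
  bounded by its trace, hence by the cost at \<open>u = 0\<close>.
\<close>

section \<open>Transposes, traces and inverses of matrices\<close>

lemma inner_transpose_mult: "x \<bullet> (transpose M *v y) = (M *v x) \<bullet> y"
  for M :: "real^'n^'m"
  by (metis dot_lmul_matrix inner_commute transpose_matrix_vector)

lemma transpose_add: "transpose (X + Y) = transpose X + transpose Y"
  by (simp add: transpose_def vec_eq_iff)

lemma transpose_diff: "transpose (X - Y) = transpose X - transpose Y"
  by (simp add: transpose_def vec_eq_iff)

lemma trace_scaleR: "trace (c *\<^sub>R X) = c * trace X"
  by (simp add: trace_def sum_distrib_left)

lemma matrix_inv_inverse:
  fixes M :: "real^'n^'n"
  assumes "invertible M"
  shows "M ** matrix_inv M = mat 1" "matrix_inv M ** M = mat 1"
  using someI_ex[OF assms[unfolded invertible_def]] by (auto simp: matrix_inv_def)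

text \<open>Transposing \<open>M ** matrix_inv M = mat 1\<close> makes the transposed inverse a left
  inverse of the symmetric \<open>M\<close>, and a left inverse equals the right one.\<close>

lemma transpose_matrix_inv:
  fixes M :: "real^'n^'n"
  assumes "invertible M" "transpose M = M"
  shows "transpose (matrix_inv M) = matrix_inv M"
proof -
  have "transpose (matrix_inv M) ** M = mat 1"
    using matrix_inv_inverse(1)[OF assms(1)] assms(2)
    by (metis matrix_transpose_mul transpose_mat)
  then show ?thesis
    by (metis assms(1) matrix_inv_inverse(1) matrix_mul_assoc matrix_mul_lid matrix_mul_rid)
qed

section \<open>Continuity of matrix operations, including inversion\<close>

lemma continuous_on_matrix_mult [continuous_intros]:
  fixes f :: "'a::topological_space \<Rightarrow> real^'n^'m" and g :: "'a \<Rightarrow> real^'p^'n"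
  assumes "continuous_on S f" "continuous_on S g"
  shows "continuous_on S (\<lambda>x. f x ** g x)"
  unfolding matrix_matrix_mult_def by (intro continuous_intros assms)

lemma continuous_on_det [continuous_intros]:
  fixes f :: "'a::topological_space \<Rightarrow> real^'n^'n"
  assumes "continuous_on S f"
  shows "continuous_on S (\<lambda>x. det (f x))"
  unfolding det_def by (intro continuous_intros assms)

lemma continuous_on_trace [continuous_intros]:
  fixes f :: "'a::topological_space \<Rightarrow> real^'n^'n"
  assumes "continuous_on S f"
  shows "continuous_on S (\<lambda>x. trace (f x))"
  unfolding trace_def by (intro continuous_intros assms)

text \<open>Column \<open>l\<close> of the inverse solves \<open>M *v x = axis l 1\<close>, so
  Cramer's rule applies. Each entry becomes a quotient of determinants, which makes inversion
  visibly continuous.\<close>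

lemma matrix_inv_cramer:
  fixes M :: "real^'n^'n"
  assumes "invertible M"
  shows "matrix_inv M =
    (\<chi> k l. det (\<chi> i j. if j = k then axis l 1 $ i else M $ i $ j) / det M)"
proof -
  have "matrix_inv M $ k $ l = det (\<chi> i j. if j = k then axis l 1 $ i else M $ i $ j) / det M"
    for k l
  proof -
    have "M *v (matrix_inv M *v axis l 1) = axis l 1"
      by (simp add: matrix_vector_mul_assoc matrix_inv_inverse(1)[OF assms])
    then have "matrix_inv M *v axis l 1 =
        (\<chi> k. det (\<chi> i j. if j = k then axis l 1 $ i else M $ i $ j) / det M)"
      using cramer[of M "matrix_inv M *v axis l 1" "axis l 1"] assms by (simp add: invertible_det_nz)
    moreover have "(matrix_inv M *v axis l 1) $ k = matrix_inv M $ k $ l"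
      by (simp add: matrix_vector_mult_basis column_def)
    ultimately show ?thesis
      by simp
  qed
  then show ?thesis
    by (simp add: vec_eq_iff)
qed

lemma continuous_on_matrix_inv:
  fixes f :: "'a::topological_space \<Rightarrow> real^'n^'n"
  assumes "continuous_on S f" "\<And>x. x \<in> S \<Longrightarrow> invertible (f x)"
  shows "continuous_on S (\<lambda>x. matrix_inv (f x))"
proof -
  \<comment> \<open>The matrices in the numerators have one constant column; their other entries are
    those of \<open>f x\<close>.\<close>
  have entry: "continuous_on S (\<lambda>x. if j = k then c else f x $ i $ j)" for i j k :: 'n and c :: real
    by (cases "j = k") (auto intro!: continuous_intros assms)
  have "continuous_on S (\<lambda>x. \<chi> k l. det (\<chi> i j. if j = k then axis l 1 $ i else f x $ i $ j) / det (f x))"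
    using assms(2) by (intro continuous_intros entry assms(1)) (auto simp: invertible_det_nz)
  then show ?thesis
    by (rule continuous_on_eq) (simp add: matrix_inv_cramer assms(2))
qed

section \<open>The positive semidefinite cone and the Loewner order\<close>

lemma psd_cone_sym: "X \<in> psd_cone \<Longrightarrow> transpose X = X"
  and psd_cone_nonneg: "X \<in> psd_cone \<Longrightarrow> 0 \<le> v \<bullet> (X *v v)"
  and psd_coneI: "transpose X = X \<Longrightarrow> (\<And>v. 0 \<le> v \<bullet> (X *v v)) \<Longrightarrow> X \<in> psd_cone"
  by (auto simp: psd_cone_def sym_mats_def)

lemma inner_mult_axis: "axis i 1 \<bullet> (X *v axis j 1) = X $ i $ j" for X :: "real^'n^'n"
  by (simp add: inner_axis' matrix_vector_mult_basis column_def)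

lemma psd_cone_diag_nonneg: "X \<in> psd_cone \<Longrightarrow> 0 \<le> X $ i $ i"
  by (metis inner_mult_axis psd_cone_nonneg)

lemma psd_cone_diag_le_trace: "X \<in> psd_cone \<Longrightarrow> X $ i $ i \<le> trace X"
  unfolding trace_def by (intro member_le_sum) (auto intro: psd_cone_diag_nonneg)

lemma psd_cone_trace_nonneg: "X \<in> psd_cone \<Longrightarrow> 0 \<le> trace X"
  unfolding trace_def by (intro sum_nonneg) (auto intro: psd_cone_diag_nonneg)

text \<open>Testing the form on the sum and the difference of two basis vectors bounds twice the
  absolute value of the entry by two diagonal entries, each at most the trace.\<close>

lemma psd_cone_entry_le_trace:
  assumes "X \<in> psd_cone"
  shows "\<bar>X $ i $ j\<bar> \<le> trace X"
proof -
  have sym: "X $ j $ i = X $ i $ j"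
    using psd_cone_sym[OF assms] by (metis transpose_def vec_lambda_beta)
  have "0 \<le> X $ i $ i + 2 * X $ i $ j + X $ j $ j"
    using psd_cone_nonneg[OF assms, of "axis i 1 + axis j 1"] sym
    by (simp add: algebra_simps inner_mult_axis)
  moreover have "0 \<le> X $ i $ i - 2 * X $ i $ j + X $ j $ j"
    using psd_cone_nonneg[OF assms, of "axis i 1 - axis j 1"] sym
    by (simp add: algebra_simps inner_mult_axis)
  ultimately show ?thesis
    using psd_cone_diag_le_trace[OF assms, of i] psd_cone_diag_le_trace[OF assms, of j] by linarith
qed

lemma psd_cone_trace_eq_0: "X \<in> psd_cone \<Longrightarrow> trace X = 0 \<longleftrightarrow> X = 0"
proof
  assume "X \<in> psd_cone" "trace X = 0"
  then show "X = 0"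
    using psd_cone_entry_le_trace[of X] by (simp add: vec_eq_iff)
qed (simp add: trace_def)

lemma psd_cone_trace_pos: "X \<in> psd_cone \<Longrightarrow> X \<noteq> 0 \<Longrightarrow> 0 < trace X"
  using psd_cone_trace_nonneg psd_cone_trace_eq_0 by (metis less_eq_real_def)

lemma psd_cone_zero: "0 \<in> psd_cone"
  by (simp add: psd_cone_def sym_mats_def transpose_def vec_eq_iff)

lemma psd_cone_add: "X \<in> psd_cone \<Longrightarrow> Y \<in> psd_cone \<Longrightarrow> X + Y \<in> psd_cone"
  by (auto simp: psd_cone_def sym_mats_def transpose_add algebra_simps)

lemma psd_cone_scaleR: "X \<in> psd_cone \<Longrightarrow> 0 \<le> c \<Longrightarrow> c *\<^sub>R X \<in> psd_cone"
  by (auto simp: psd_cone_def sym_mats_def transpose_scalar simp flip: scaleR_matrix_vector_assoc)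

lemma loewner_leI:
  assumes "X \<in> psd_cone" "Y \<in> psd_cone" "\<And>v. v \<bullet> (X *v v) \<le> v \<bullet> (Y *v v)"
  shows "X \<preceq> Y"
  using assms unfolding loewner_le_def
  by (auto intro!: psd_coneI simp: transpose_diff psd_cone_sym algebra_simps)

lemma loewner_le_quad: "X \<preceq> Y \<Longrightarrow> v \<bullet> (X *v v) \<le> v \<bullet> (Y *v v)"
  unfolding loewner_le_def using psd_cone_nonneg[of "Y - X" v] by (simp add: algebra_simps)

lemma loewner_le_trans: "X \<preceq> Y \<Longrightarrow> Y \<preceq> Z \<Longrightarrow> X \<preceq> Z"
  unfolding loewner_le_def using psd_cone_add[of "Y - X" "Z - Y"] by simp

text \<open>The trace of \<open>Y - X\<close> is both nonnegative and nonpositive, and an element of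
  the cone with trace 0 is 0.\<close>

lemma loewner_le_antisym:
  assumes "X \<preceq> Y" "Y \<preceq> X"
  shows "X = Y"
proof -
  have "trace (Y - X) = 0"
    using psd_cone_trace_nonneg[of "Y - X"] psd_cone_trace_nonneg[of "X - Y"] assms
    by (simp add: loewner_le_def trace_sub)
  then show ?thesis
    using assms(1) psd_cone_trace_eq_0[of "Y - X"] by (simp add: loewner_le_def)
qed

lemma zero_loewner_le: "0 \<preceq> X \<longleftrightarrow> X \<in> psd_cone"
  by (simp add: loewner_le_def)

lemma pos_def_imp_psd:
  assumes "pos_def M"
  shows "M \<in> psd_cone"
proof -
  have "0 \<le> v \<bullet> (M *v v)" for v
    using assms by (cases "v = 0") (simp_all add: pos_def_def less_imp_le)
  then show ?thesis
    using assms by (simp add: pos_def_def psd_cone_def)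
qed

lemma pos_def_invertible:
  assumes "pos_def M"
  shows "invertible M"
proof -
  have "x = 0" if "M *v x = 0" for x
    using assms that unfolding pos_def_def by (metis inner_zero_right less_irrefl)
  then show ?thesis
    using invertible_left_inverse matrix_left_invertible_ker by blast
qed

section \<open>The cost of a control \<open>u\<close> and its minimum over \<open>u\<close>\<close>

locale riccati =
  fixes A :: "real^'n^'n" and B :: "real^'p^'n" and C :: "real^'n^'m"
    and R :: "real^'p^'p" and \<alpha> :: real
  assumes R: "pos_def R" and \<alpha>: "\<alpha> > 0"
begin

abbreviation F :: "real^'n^'n \<Rightarrow> real^'n^'n" where
  "F \<equiv> riccati_F A B C R \<alpha>"

definition cost :: "real^'n^'n \<Rightarrow> real^'n \<Rightarrow> real^'p \<Rightarrow> real" where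
  "cost X v u = (A *v v - B *v u) \<bullet> (X *v (A *v v - B *v u))
     + \<alpha> * trace X * (u \<bullet> (R *v u)) + \<alpha> * trace X * ((C *v v) \<bullet> (C *v v))"

text \<open>The matrix of the part of \<open>cost X v u\<close> that is quadratic in
  \<open>u\<close>, and also the matrix inverted in \<open>riccati_S\<close>.\<close>

definition gram :: "real^'n^'n \<Rightarrow> real^'p^'p" where
  "gram X = (\<alpha> * trace X) *\<^sub>R R + transpose B ** X ** B"

lemma R_nonneg: "0 \<le> u \<bullet> (R *v u)"
  by (rule psd_cone_nonneg[OF pos_def_imp_psd[OF R]])

lemma cost_nonneg: "X \<in> psd_cone \<Longrightarrow> 0 \<le> cost X v u"
  unfolding cost_def using \<alpha> psd_cone_trace_nonneg
  by (intro add_nonneg_nonneg mult_nonneg_nonneg psd_cone_nonneg R_nonneg) auto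

lemma cost_add: "cost (X + Y) v u = cost X v u + cost Y v u"
  by (simp add: cost_def trace_add matrix_vector_mult_add_rdistrib inner_add_right algebra_simps)

lemma cost_scaleR: "cost (c *\<^sub>R X) v u = c * cost X v u"
  by (simp add: cost_def trace_scaleR distrib_left flip: scaleR_matrix_vector_assoc)

lemma gram_quad: "u \<bullet> (gram X *v u) = \<alpha> * trace X * (u \<bullet> (R *v u)) + (B *v u) \<bullet> (X *v (B *v u))"
  by (simp add: gram_def matrix_vector_mult_add_rdistrib inner_add_right inner_transpose_mult
      del: transpose_matrix_vector flip: matrix_vector_mul_assoc scaleR_matrix_vector_assoc)

lemma gram_sym:
  assumes "X \<in> psd_cone"
  shows "transpose (gram X) = gram X"
  using R psd_cone_sym[OF assms]
  by (simp add: gram_def pos_def_def sym_mats_def transpose_add transpose_scalar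
      matrix_transpose_mul matrix_mul_assoc)

lemma gram_pos_def:
  assumes "X \<in> psd_cone" "X \<noteq> 0"
  shows "pos_def (gram X)"
proof -
  have "0 < u \<bullet> (gram X *v u)" if "u \<noteq> 0" for u
    unfolding gram_quad using that R \<alpha> psd_cone_trace_pos[OF assms] psd_cone_nonneg[OF assms(1)]
    by (intro add_pos_nonneg mult_pos_pos) (auto simp: pos_def_def)
  then show ?thesis
    using gram_sym[OF assms(1)] by (simp add: pos_def_def sym_mats_def)
qed

lemma F_0: "F 0 = 0"
  by (simp add: riccati_F_def)

lemma F_nonzero: "X \<noteq> 0 \<Longrightarrow> F X = transpose A ** (X - X ** B ** matrix_inv (gram X) ** transpose B ** X) ** A
    + (\<alpha> * trace X) *\<^sub>R (transpose C ** C)"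
  by (simp add: riccati_F_def riccati_S_def gram_def)

text \<open>For nonzero \<open>X\<close> in the cone, the unique minimiser of the cost over
  \<open>u\<close>.\<close>

definition opt :: "real^'n^'n \<Rightarrow> real^'n \<Rightarrow> real^'p" where
  "opt X v = matrix_inv (gram X) *v (transpose B *v (X *v (A *v v)))"

lemma cost_eq:
  assumes "X \<in> psd_cone" "X \<noteq> 0"
  shows "cost X v u = v \<bullet> (F X *v v) + (u - opt X v) \<bullet> (gram X *v (u - opt X v))"
proof -
  define w where "w = A *v v"
  define b where "b = transpose B *v (X *v w)"
  define s where "s = opt X v"
  have X: "x \<bullet> (X *v y) = (X *v x) \<bullet> y" for x y
    by (metis inner_transpose_mult psd_cone_sym[OF assms(1)])
  have G: "x \<bullet> (gram X *v y) = (gram X *v x) \<bullet> y" for x y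
    by (metis inner_transpose_mult gram_sym[OF assms(1)])
  have s: "s = matrix_inv (gram X) *v b"
    by (simp only: s_def opt_def b_def w_def)
  \<comment> \<open>The normal equation: the gradient of the cost in \<open>u\<close> vanishes at
    \<open>s\<close>.\<close>
  have go: "gram X *v s = b"
    using matrix_inv_inverse(1)[OF pos_def_invertible[OF gram_pos_def[OF assms]]]
    by (simp add: s matrix_vector_mul_assoc)
  have ub: "u \<bullet> b = (B *v u) \<bullet> (X *v w)" for u
    by (simp only: b_def inner_transpose_mult)
  have F: "v \<bullet> (F X *v v) = w \<bullet> (X *v w) - b \<bullet> s + \<alpha> * trace X * ((C *v v) \<bullet> (C *v v))"
  proof -
    have "F X *v v = transpose A *v (X *v w - X *v (B *v s))
        + (\<alpha> * trace X) *\<^sub>R (transpose C *v (C *v v))"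
      unfolding F_nonzero[OF assms(2)] s b_def w_def
      by (simp add: matrix_vector_mult_add_rdistrib matrix_vector_mult_diff_rdistrib
          del: transpose_matrix_vector flip: matrix_vector_mul_assoc scaleR_matrix_vector_assoc)
    moreover have "w \<bullet> (X *v (B *v s)) = b \<bullet> s"
      using ub[of s] X[of w "B *v s"] by (simp only: inner_commute)
    ultimately show ?thesis
      by (simp add: inner_add_right inner_transpose_mult inner_diff_right w_def
          del: transpose_matrix_vector)
  qed
  have sq: "(u - s) \<bullet> (gram X *v (u - s)) = u \<bullet> (gram X *v u) - 2 * (u \<bullet> b) + b \<bullet> s"
    using G[of s u] by (simp add: algebra_simps go inner_commute)
  have "(w - B *v u) \<bullet> (X *v (w - B *v u)) = w \<bullet> (X *v w) - 2 * (u \<bullet> b) + (B *v u) \<bullet> (X *v (B *v u))"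
    using X[of w "B *v u"] ub[of u]
    by (simp add: matrix_vector_mult_diff_distrib inner_diff_left inner_diff_right inner_commute)
  then show ?thesis
    using F sq gram_quad[of u X] unfolding cost_def w_def[symmetric] s_def[symmetric] by linarith
qed

lemma F_le_cost:
  assumes "X \<in> psd_cone"
  shows "v \<bullet> (F X *v v) \<le> cost X v u"
proof (cases "X = 0")
  case True
  then show ?thesis
    using cost_nonneg[OF assms] by (simp add: F_0)
next
  case False
  show ?thesis
    using psd_cone_nonneg[OF pos_def_imp_psd[OF gram_pos_def[OF assms False]], of "u - opt X v"]
    by (simp add: cost_eq[OF assms False])
qed

lemma F_attains_cost:
  assumes "X \<in> psd_cone"
  obtains u where "v \<bullet> (F X *v v) = cost X v u"
proof (cases "X = 0")
  case True
  \<comment> \<open>For \<open>X = 0\<close> the cost vanishes identically, so any control serves as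
    the witness.\<close>
  then show ?thesis
    using that[of 0] by (simp add: F_0 cost_def trace_def)
next
  case False
  then show ?thesis
    using that[of "opt X v"] by (simp add: cost_eq[OF assms False])
qed

section \<open>Invariance of the cone, homogeneity, concavity and monotonicity\<close>

lemma F_psd:
  assumes "X \<in> psd_cone"
  shows "F X \<in> psd_cone"
proof (rule psd_coneI)
  show "0 \<le> v \<bullet> (F X *v v)" for v
    by (metis F_attains_cost assms cost_nonneg)
  show "transpose (F X) = F X"
  proof (cases "X = 0")
    case False
    then show ?thesis
      using psd_cone_sym[OF assms]
        transpose_matrix_inv[OF pos_def_invertible[OF gram_pos_def[OF assms False]] gram_sym[OF assms]]
      by (simp add: F_nonzero transpose_add transpose_diff transpose_scalar matrix_transpose_mul
          matrix_mul_assoc)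
  qed (simp add: F_0 psd_cone_sym psd_cone_zero)
qed

text \<open>A minimiser for \<open>X + Y\<close> is a competitor for both \<open>X\<close> and
  \<open>Y\<close>, so the minimum of the summed costs is at least the sum of the two
  minima.\<close>

lemma F_superadditive:
  assumes "X \<in> psd_cone" "Y \<in> psd_cone"
  shows "F X + F Y \<preceq> F (X + Y)"
proof (rule loewner_leI)
  fix v
  obtain u where "v \<bullet> (F (X + Y) *v v) = cost (X + Y) v u"
    using F_attains_cost psd_cone_add assms by metis
  then show "v \<bullet> ((F X + F Y) *v v) \<le> v \<bullet> (F (X + Y) *v v)"
    using F_le_cost[OF assms(1), of v u] F_le_cost[OF assms(2), of v u]
    by (simp add: cost_add algebra_simps)
qed (auto intro: psd_cone_add F_psd assms)

text \<open>The optimal control for \<open>c *\<^sub>R X\<close> competes for \<open>X\<close>;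
  \<open>F_scaleR_le\<close> swaps the roles. Since neither direction divides by \<open>c\<close>,
  homogeneity at \<open>c = 0\<close> needs no separate case.\<close>

lemma F_scaleR_ge:
  assumes "X \<in> psd_cone" "0 \<le> c"
  shows "c *\<^sub>R F X \<preceq> F (c *\<^sub>R X)"
proof (rule loewner_leI)
  fix v
  obtain u where "v \<bullet> (F (c *\<^sub>R X) *v v) = cost (c *\<^sub>R X) v u"
    using F_attains_cost psd_cone_scaleR assms by metis
  then show "v \<bullet> ((c *\<^sub>R F X) *v v) \<le> v \<bullet> (F (c *\<^sub>R X) *v v)"
    using mult_left_mono[OF F_le_cost[OF assms(1), of v u] assms(2)]
    by (simp add: cost_scaleR flip: scaleR_matrix_vector_assoc)
qed (auto intro: psd_cone_scaleR F_psd assms)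

lemma F_scaleR_le:
  assumes "X \<in> psd_cone" "0 \<le> c"
  shows "F (c *\<^sub>R X) \<preceq> c *\<^sub>R F X"
proof (rule loewner_leI)
  fix v
  obtain u where "v \<bullet> (F X *v v) = cost X v u"
    using F_attains_cost assms by metis
  then show "v \<bullet> (F (c *\<^sub>R X) *v v) \<le> v \<bullet> ((c *\<^sub>R F X) *v v)"
    using F_le_cost[OF psd_cone_scaleR[OF assms], of v u]
    by (simp add: cost_scaleR flip: scaleR_matrix_vector_assoc)
qed (auto intro: psd_cone_scaleR F_psd assms)

lemma F_homogeneous: "homogeneous F"
  unfolding homogeneous_def by (blast intro: loewner_le_antisym F_scaleR_le F_scaleR_ge)

lemma F_concave: "loewner_concave F"
  unfolding loewner_concave_def
proof (intro ballI)
  fix X Y :: "real^'n^'n" and \<theta> :: real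
  assume *: "X \<in> psd_cone" "Y \<in> psd_cone" "\<theta> \<in> {0..1}"
  then have "F (\<theta> *\<^sub>R X) = \<theta> *\<^sub>R F X" "F ((1 - \<theta>) *\<^sub>R Y) = (1 - \<theta>) *\<^sub>R F Y"
    using F_homogeneous by (auto simp: homogeneous_def)
  then show "\<theta> *\<^sub>R F X + (1 - \<theta>) *\<^sub>R F Y \<preceq> F (\<theta> *\<^sub>R X + (1 - \<theta>) *\<^sub>R Y)"
    using F_superadditive[of "\<theta> *\<^sub>R X" "(1 - \<theta>) *\<^sub>R Y"] * by (simp add: psd_cone_scaleR)
qed

lemma F_diff:
  assumes "X \<in> psd_cone" "X \<preceq> Y"
  shows "F (Y - X) \<preceq> F Y - F X"
  using F_superadditive[of X "Y - X"] assms by (simp add: loewner_le_def algebra_simps)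

lemma F_mono:
  assumes "X \<in> psd_cone" "X \<preceq> Y"
  shows "F X \<preceq> F Y"
proof -
  have "0 \<preceq> F (Y - X)"
    using assms by (simp add: zero_loewner_le F_psd loewner_le_def)
  then have "0 \<preceq> F Y - F X"
    using F_diff[OF assms] loewner_le_trans by blast
  then show ?thesis
    by (simp add: loewner_le_def)
qed

lemma F_order_preserving: "order_preserving F"
  unfolding order_preserving_def by (auto simp: zero_loewner_le intro: F_psd F_mono)

section \<open>Continuity of \<open>F\<close> on the cone\<close>

lemma F_continuous: "continuous_on psd_cone F"
proof -
  have inv: "continuous_on (psd_cone - {0}) (\<lambda>X. matrix_inv (gram X))"
    unfolding gram_def
    by (intro continuous_on_matrix_inv continuous_intros)
      (auto intro!: pos_def_invertible gram_pos_def[unfolded gram_def])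
  have "continuous_on (psd_cone - {0}) (\<lambda>X. transpose A ** (X - X ** B ** matrix_inv (gram X) ** transpose B ** X) ** A
    + (\<alpha> * trace X) *\<^sub>R (transpose C ** C))"
    by (intro continuous_intros inv)
  then have nz: "continuous_on (psd_cone - {0}) F"
    by (rule continuous_on_eq) (simp add: F_nonzero)
  \<comment> \<open>A bound for the limit at 0: on the cone it dominates the trace of
    \<open>F X\<close>, hence every entry, and being continuous with \<open>bd 0 = 0\<close> it
    forces \<open>F X\<close> to 0.\<close>
  define bd where "bd X = (\<Sum>k\<in>UNIV. cost X (axis k 1) 0)" for X
  have "continuous_on UNIV bd"
    unfolding bd_def cost_def matrix_vector_mult_def by (intro continuous_intros)
  then have "(bd \<longlongrightarrow> bd 0) (at 0 within psd_cone)"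
    by (metis continuous_on_def continuous_on_subset psd_cone_zero top_greatest)
  moreover have "bd 0 = 0"
    by (simp add: bd_def cost_def trace_def)
  ultimately have bd: "(bd \<longlongrightarrow> 0) (at 0 within psd_cone)"
    by simp
  have le: "norm (F X $ i $ j) \<le> bd X" if X: "X \<in> psd_cone" for X i j
  proof -
    have "\<bar>F X $ i $ j\<bar> \<le> trace (F X)"
      by (rule psd_cone_entry_le_trace[OF F_psd[OF X]])
    also have "\<dots> \<le> bd X"
      unfolding trace_def bd_def
      by (intro sum_mono) (metis F_le_cost X inner_mult_axis)
    finally show ?thesis
      by simp
  qed
  have "((\<lambda>X. F X $ i $ j) \<longlongrightarrow> 0 $ i $ j) (at 0 within psd_cone)" for i j
    using Lim_null_comparison[OF _ bd, of "\<lambda>X. F X $ i $ j"] le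
    by (simp add: eventually_at_filter)
  then have zero: "(F \<longlongrightarrow> F 0) (at 0 within psd_cone)"
    unfolding F_0 by (intro vec_tendstoI)
  show ?thesis
    unfolding continuous_on_def
  proof
    fix X :: "real^'n^'n"
    assume X: "X \<in> psd_cone"
    show "(F \<longlongrightarrow> F X) (at X within psd_cone)"
    proof (cases "X = 0")
      case False
      then have "(F \<longlongrightarrow> F X) (at X within psd_cone - {0})"
        using nz X by (simp add: continuous_on_def)
      \<comment> \<open>Removing the point 0 does not affect limits at a nonzero
        \<open>X\<close>.\<close>
      moreover have "at X within psd_cone - {0} = at X within psd_cone"
        using False by (intro at_within_nhd[of X "- {0}"]) auto
      ultimately show ?thesis
        by simp
    qed (use zero in simp)
  qed
qed

section \<open>Iterates of \<open>F\<close> and strong order preservation\<close>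

lemma F_pow_psd: "X \<in> psd_cone \<Longrightarrow> (F ^^ k) X \<in> psd_cone"
  by (induction k) (auto intro: F_psd)

lemma F_pow_mono: "X \<in> psd_cone \<Longrightarrow> X \<preceq> Y \<Longrightarrow> (F ^^ k) X \<preceq> (F ^^ k) Y"
  by (induction k) (auto intro: F_mono F_pow_psd)

text \<open>In the inductive step, monotonicity applies \<open>F\<close> to the induction
  hypothesis, and \<open>F_diff\<close> then splits \<open>F\<close> of the difference of the two
  iterates.\<close>

lemma F_pow_diff:
  assumes "X \<in> psd_cone" "X \<preceq> Y"
  shows "(F ^^ k) (Y - X) \<preceq> (F ^^ k) Y - (F ^^ k) X"
proof (induction k)
  case 0
  then show ?case
    by (simp add: loewner_le_def psd_cone_zero)
next
  case (Suc k)
  have "F ((F ^^ k) (Y - X)) \<preceq> F ((F ^^ k) Y - (F ^^ k) X)"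
    using Suc assms by (intro F_mono F_pow_psd) (auto simp: loewner_le_def)
  also have "\<dots> \<preceq> F ((F ^^ k) Y) - F ((F ^^ k) X)"
    using assms by (intro F_diff F_pow_psd F_pow_mono)
  finally (loewner_le_trans) show ?case
    by simp
qed

lemma F_quad_eq_0D:
  assumes "X \<in> psd_cone" "X \<noteq> 0" "v \<bullet> (F X *v v) = 0"
  shows "C *v v = 0" "(A *v v) \<bullet> (X *v (A *v v)) = 0"
proof -
  obtain u where u: "cost X v u = 0"
    using F_attains_cost[OF assms(1)] assms(3) by metis
  have t: "0 < \<alpha> * trace X"
    using \<alpha> psd_cone_trace_pos[OF assms(1,2)] by simp
  let ?q = "(A *v v - B *v u) \<bullet> (X *v (A *v v - B *v u))"
  let ?r = "\<alpha> * trace X * (u \<bullet> (R *v u))"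
  let ?c = "\<alpha> * trace X * ((C *v v) \<bullet> (C *v v))"
  have "0 \<le> ?q" "0 \<le> ?r" "0 \<le> ?c"
    using t R_nonneg psd_cone_nonneg[OF assms(1)] by auto
  then have eq: "?q = 0" "?r = 0" "?c = 0"
    using u unfolding cost_def by linarith+
  show "C *v v = 0"
    using eq(3) t by (metis inner_eq_zero_iff less_irrefl mult_eq_0_iff)
  \<comment> \<open>With a positive trace and definite \<open>R\<close>, the control term vanishes
    only at \<open>u = 0\<close>; then \<open>?q\<close> is the form of \<open>X\<close> at
    \<open>A *v v\<close>.\<close>
  have "u = 0"
    using eq(2) t R unfolding pos_def_def by (metis less_irrefl mult_eq_0_iff)
  then show "(A *v v) \<bullet> (X *v (A *v v)) = 0"
    using eq(1) by simp
qed

text \<open>\<open>mat_pow\<close> adds factors on the left, whereas the descent through the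
  iterates adds them on the right, next to the vector.\<close>

lemma mat_pow_Suc_vec: "mat_pow A k *v (A *v v) = mat_pow A (Suc k) *v v"
  by (induction k) (simp_all add: mat_pow_def flip: matrix_vector_mul_assoc)

text \<open>Each application of \<open>F_quad_eq_0D\<close> removes one \<open>F\<close> and
  replaces \<open>v\<close> by \<open>A *v v\<close>, hence the induction over arbitrary
  \<open>v\<close>. The intermediate iterates must be nonzero for their traces to be
  positive.\<close>

lemma F_pow_quad_eq_0D:
  assumes "X \<in> psd_cone" "\<And>j. j < k \<Longrightarrow> (F ^^ j) X \<noteq> 0" "v \<bullet> ((F ^^ k) X *v v) = 0" "j < k"
  shows "C *v (mat_pow A j *v v) = 0"
  using assms(2-4)
proof (induction k arbitrary: v j)
  case (Suc k)
  have *: "C *v v = 0" "(A *v v) \<bullet> ((F ^^ k) X *v (A *v v)) = 0"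
    using F_quad_eq_0D[of "(F ^^ k) X" v] Suc.prems(1,2) by (auto simp: F_pow_psd assms(1))
  show ?case
  proof (cases j)
    case 0
    then show ?thesis
      using *(1) by (simp add: mat_pow_def)
  next
    case (Suc i)
    then show ?thesis
      using Suc.IH[of "A *v v" i] Suc.prems *(2) by (simp add: mat_pow_Suc_vec)
  qed
qed simp

text \<open>Full column rank means a trivial kernel, and each row of the stacked matrix lies in a
  block with exponent below \<open>CARD('n)\<close>.\<close>

lemma observable_ker:
  assumes "observable A C" "\<And>j. j < CARD('n) \<Longrightarrow> C *v (mat_pow A j *v v) = 0"
  shows "v = 0"
proof -
  have "obs_matrix A C *v v = 0"
  proof (rule vec_eq_iff[THEN iffD2], rule allI)
    fix r :: "'n \<times> 'm"
    let ?j = "to_nat_on (UNIV :: 'n set) (fst r)"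
    have "?j < CARD('n)"
      using to_nat_on_finite[of "UNIV :: 'n set"] by (auto simp: bij_betw_def)
    then have "((C ** mat_pow A ?j) *v v) $ snd r = 0"
      using assms(2) by (simp flip: matrix_vector_mul_assoc)
    then show "(obs_matrix A C *v v) $ r = 0 $ r"
      by (simp add: obs_matrix_def matrix_vector_mult_def)
  qed
  then show ?thesis
    using assms(1) matrix_nonfull_linear_equations_eq unfolding observable_def by blast
qed

text \<open>If \<open>F X\<close> were 0, every \<open>v\<close> would be isotropic for it, so
  \<open>C\<close> would annihilate every vector and observability would fail. This keeps all
  iterates of a nonzero \<open>X\<close> nonzero.\<close>

lemma F_neq_0:
  assumes "observable A C" "X \<in> psd_cone" "X \<noteq> 0"
  shows "F X \<noteq> 0"
proof
  assume "F X = 0"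
  then have C: "C *v v = 0" for v
    using F_quad_eq_0D(1)[OF assms(2,3), of v] by simp
  have "axis i 1 = (0 :: real^'n)" for i
    by (rule observable_ker[OF assms(1)]) (rule C)
  then show False
    by (simp add: axis_eq_0_iff)
qed

lemma F_pow_pos_def:
  assumes "observable A C" "X \<in> psd_cone" "X \<noteq> 0"
  shows "pos_def ((F ^^ CARD('n)) X)"
proof -
  have nz: "(F ^^ k) X \<noteq> 0" for k
    by (induction k) (auto simp: assms F_neq_0 F_pow_psd)
  have "v = 0" if "v \<bullet> ((F ^^ CARD('n)) X *v v) = 0" for v
    by (rule observable_ker[OF assms(1)]) (rule F_pow_quad_eq_0D[OF assms(2) nz that])
  then show ?thesis
    using F_pow_psd[OF assms(2), of "CARD('n)"]
    by (auto simp: pos_def_def psd_cone_def less_eq_real_def)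
qed

lemma F_pow_strongly_order_preserving:
  assumes "observable A C"
  shows "strongly_order_preserving (F ^^ CARD('n))"
  unfolding strongly_order_preserving_def psd_int_eq_pos_def
proof (intro allI impI CollectI, elim conjE)
  fix X Y :: "real^'n^'n"
  assume X: "0 \<preceq> X" and Y: "X \<preceq> Y" and "X \<noteq> Y"
  then have pd: "pos_def ((F ^^ CARD('n)) (Y - X))"
    using F_pow_pos_def[OF assms, of "Y - X"] by (simp add: loewner_le_def)
  have X: "X \<in> psd_cone"
    using X by (simp add: zero_loewner_le)
  show "pos_def ((F ^^ CARD('n)) Y - (F ^^ CARD('n)) X)"
    \<comment> \<open>\<open>F_pow_diff\<close> bounds the form of the difference below by a
      positive one; \<open>F_pow_mono\<close> supplies its symmetry.\<close>
    using pd loewner_le_quad[OF F_pow_diff[OF X Y, of "CARD('n)"]]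
      F_pow_mono[OF X Y, of "CARD('n)"]
    by (auto simp: pos_def_def loewner_le_def psd_cone_def intro: less_le_trans)
qed

end

theorem lemma3:
  fixes A :: "real^'n^'n" and B :: "real^'p^'n" and C :: "real^'n^'m"
    and R :: "real^'p^'p" and \<alpha> :: real
  assumes "pos_def R" and "\<alpha> > 0"
  shows "riccati_F A B C R \<alpha> \<in> psd_cone \<rightarrow> psd_cone
     \<and> continuous_on psd_cone (riccati_F A B C R \<alpha>)
     \<and> homogeneous (riccati_F A B C R \<alpha>)
     \<and> order_preserving (riccati_F A B C R \<alpha>)
     \<and> loewner_concave (riccati_F A B C R \<alpha>)
     \<and> (observable A C \<longrightarrow> strongly_order_preserving (riccati_F A B C R \<alpha> ^^ CARD('n)))"
proof -
  interpret riccati A B C R \<alpha>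
    by standard (fact assms)+
  show ?thesis
    using F_psd F_continuous F_homogeneous F_order_preserving F_concave
      F_pow_strongly_order_preserving by blast
qed

end
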